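(* Let \[ f(\alpha;q)=\sum_{n=0}^\infty \frac{q^{n^2-n}\alpha^n}{(-q;q)_n(-\alpha;q)_n},\quad \phi(\alpha;q)=\sum_{n=0}^\infty \frac{q^{n^2}}{(-\alpha q;q^2)_n},\quad \psi(\alpha;q)=\sum_{n=1}^\infty \frac{q^{n^2}}{(\alpha;q^2)_n}. \] Then \begin{align*} f(\alpha q;q)&=1+\sum_{\lambda \in P} (-1)^{r(\lambda)}\alpha^{\lambda_1}q^{|\lambda|},\\ \phi(-\alpha q;-q)&=1+\sum_{\lambda \in DO}(-1)^{\frac{\lambda_1+1}{2}}\alpha^{\frac{\lambda_1+1}{2}-l(\lambda)}q^{|\lambda|},\\ \psi(-\alpha q;-q)&=\sum_{\lambda \in OC}(-1)^{l(\lambda)} \alpha^{l(\lambda)-\frac{\lambda_1+1}{2}}q^{|\lambda|}. \end{align*}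
   Context: Notation: $(a;q)_n=(1-a)(1-aq)\cdots(1-aq^{n-1})$, $(a;q)_0=1$; identities are of formal power series in $q$ with coefficients polynomial in $\alpha$. For a partition $\lambda=(\lambda_1\ge\lambda_2\ge\cdots)$, $\lambda_1$ is its largest part, $|\lambda|$ its sum, $l(\lambda)$ its number of parts, and $r(\lambda)=\lambda_1-l(\lambda)$ its (Dyson) rank. $P$ is the set of nonempty partitions; $DO$ is the set of nonempty partitions into distinct odd parts; $OC$ is the set of nonempty partitions into odd parts without gaps, i.e. all parts are odd and every odd number from $1$ up to the largest part occurs as a part. *)

theory Defs
  imports
    "HOL-Analysis.Infinite_Sum"
    "HOL-Computational_Algebra.Polynomial"
    "HOL-Computational_Algebra.Formal_Power_Series"
begin

section \<open>q-series\<close>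

text \<open>
  Identities live in the ring of formal power series in \<open>q\<close> over the polynomial ring in \<open>\<alpha>\<close> with
  integer coefficients, i.e. in \<^typ>\<open>int poly fps\<close>, with \<open>q\<close> rendered as \<^term>\<open>fps_X\<close> and
  \<open>\<alpha>\<close> as the following constant series. Infinite sums refer to the usual topology of formal
  power series.
\<close>

abbreviation alpha :: "int poly fps" where
  "alpha \<equiv> fps_const [:0, 1:]"

text \<open>
  Polynomial rings lack the library's \<^term>\<open>inverse\<close>, so reciprocals are taken in the
  power series ring itself. Inverses in a commutative ring are unique, hence the description is
  well-defined at every unit, in particular at every series with constant coefficient \<open>1\<close>; it is
  unspecified elsewhere.
\<close>

definition recip :: "'a::comm_ring_1 \<Rightarrow> 'a" where
  "recip x = (THE y. x * y = 1)"

definition qpoch :: "'a::comm_ring_1 \<Rightarrow> 'a \<Rightarrow> nat \<Rightarrow> 'a" where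
  "qpoch a q n = (\<Prod>k<n. 1 - a * q ^ k)"

text \<open>
  The three series are functions of two ring elements, so that for instance \<open>\<phi>(-\<alpha>q; -q)\<close> is an
  ordinary application, meaning substitution in every summand.
\<close>

definition mock_f :: "'a::comm_ring_1 fps \<Rightarrow> 'a fps \<Rightarrow> 'a fps" where
  "mock_f a q = (\<Sum>n. q ^ (n\<^sup>2 - n) * a ^ n * recip (qpoch (- q) q n * qpoch (- a) q n))"

definition mock_phi :: "'a::comm_ring_1 fps \<Rightarrow> 'a fps \<Rightarrow> 'a fps" where
  "mock_phi a q = (\<Sum>n. q ^ (n\<^sup>2) * recip (qpoch (- (a * q)) (q\<^sup>2) n))"

text \<open>The sum starts at \<open>1\<close>, whence the shifted index.\<close>

definition mock_psi :: "'a::comm_ring_1 fps \<Rightarrow> 'a fps \<Rightarrow> 'a fps" where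
  "mock_psi a q = (\<Sum>n. q ^ ((Suc n)\<^sup>2) * recip (qpoch a (q\<^sup>2) (Suc n)))"


section \<open>Partitions\<close>

text \<open>
  A partition is the weakly decreasing list of its parts: the largest part is \<^const>\<open>hd\<close>, the sum
  is \<^const>\<open>sum_list\<close> and the number of parts is \<^const>\<open>length\<close>.
\<close>

definition partitions :: "nat list set" where
  "partitions = {p. p \<noteq> [] \<and> sorted_wrt (\<ge>) p \<and> (\<forall>x\<in>set p. 0 < x)}"

definition partitions_DO :: "nat list set" where
  "partitions_DO = {p \<in> partitions. distinct p \<and> (\<forall>x\<in>set p. odd x)}"

definition partitions_OC :: "nat list set" where
  "partitions_OC = {p \<in> partitions. (\<forall>x\<in>set p. odd x) \<and> (\<forall>k. odd k \<and> k \<le> hd p \<longrightarrow> k \<in> set p)}"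

definition rank :: "nat list \<Rightarrow> int" where
  "rank p = int (hd p) - int (length p)"

text \<open>The rank may be negative; the sign \<open>(-1)\<^sup>r\<close> only depends on its parity.\<close>

definition rank_sign :: "nat list \<Rightarrow> 'a::comm_ring_1" where
  "rank_sign p = (- 1) ^ nat \<bar>rank p\<bar>"


section \<open>The truncated subtractions in the exponents are exact\<close>

lemma hd_partition_ge:
  assumes "p \<in> partitions" "x \<in> set p" shows "x \<le> hd p"
  using assms by (cases p) (auto simp: partitions_def)

lemma card_odd_le: "card {k. odd k \<and> k \<le> (m::nat)} = (m + 1) div 2"
proof -
  have "{k. odd k \<and> k \<le> m} = (\<lambda>i. 2 * i + 1) ` {..<(m + 1) div 2}"
    by (force elim!: oddE)
  thus ?thesis by (simp add: card_image inj_on_def)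
qed

lemma length_le_DO:
  assumes "p \<in> partitions_DO" shows "length p \<le> (hd p + 1) div 2"
proof -
  have "length p = card (set p)"
    using assms by (simp add: partitions_DO_def distinct_card)
  also have "\<dots> \<le> card {k. odd k \<and> k \<le> hd p}"
    using assms hd_partition_ge by (intro card_mono) (auto simp: partitions_DO_def)
  finally show ?thesis by (simp add: card_odd_le)
qed

lemma length_ge_OC:
  assumes "p \<in> partitions_OC" shows "(hd p + 1) div 2 \<le> length p"
proof -
  have "card {k. odd k \<and> k \<le> hd p} \<le> card (set p)"
    using assms by (intro card_mono) (auto simp: partitions_OC_def)
  also have "\<dots> \<le> length p" by (rule card_length)
  finally show ?thesis by (simp add: card_odd_le)
qed


section \<open>Reciprocals and sums are well-defined\<close>

lemma recip_eqI:
  assumes "x * y = 1" shows "recip x = y"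
  unfolding recip_def
proof (rule the_equality)
  fix z assume "x * z = 1"
  hence "y * (x * z) = y" by simp
  moreover have "y * (x * z) = (x * y) * z" by (simp add: algebra_simps)
  ultimately show "z = y" using assms by simp
qed (fact assms)

lemma mult_recip:
  fixes x :: "'a::comm_ring_1 fps"
  assumes "fps_nth x 0 = 1" shows "x * recip x = 1"
proof -
  have "x * fps_right_inverse x 1 = 1"
    by (rule fps_right_inverse) (use assms in simp)
  thus ?thesis using recip_eqI by metis
qed

lemma qpoch_nth_0:
  assumes "fps_nth a 0 = 0" shows "fps_nth (qpoch a q n) 0 = 1"
  using assms by (induction n) (simp_all add: qpoch_def)

text \<open>All denominators occurring in the three identities are units.\<close>

lemma denominators_invertible:
  fixes n :: nat
  defines "q \<equiv> fps_X :: int poly fps"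
  defines "d1 \<equiv> qpoch (- q) q n * qpoch (- (alpha * q)) q n"
    and "d2 \<equiv> qpoch (- (- (alpha * q) * - q)) ((- q)\<^sup>2) n"
    and "d3 \<equiv> qpoch (- (alpha * q)) ((- q)\<^sup>2) n"
  shows "d1 * recip d1 = 1" "d2 * recip d2 = 1" "d3 * recip d3 = 1"
  unfolding d1_def d2_def d3_def q_def by (intro mult_recip; simp add: qpoch_nth_0)+

lemma fps_summable:
  fixes t :: "nat \<Rightarrow> 'a::comm_ring_1 fps"
  assumes "\<And>n. fps_X ^ n dvd t n"
  shows "summable t"
proof -
  have z: "fps_nth (t n) k = 0" if "k < n" for n k
    using assms[of n] that by (auto elim!: dvdE simp: fps_X_power_mult_nth)
  let ?s = "Abs_fps (\<lambda>k. \<Sum>n\<le>k. fps_nth (t n) k)"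
  have "(\<lambda>N. sum t {..<N}) \<longlonglongrightarrow> ?s"
  proof (rule tendsto_fpsI)
    fix k
    show "\<forall>\<^sub>F N in sequentially. fps_nth (sum t {..<N}) k = fps_nth ?s k"
    proof (rule eventually_sequentiallyI[of "Suc k"])
      fix N assume "Suc k \<le> N"
      hence "(\<Sum>n\<le>k. fps_nth (t n) k) = (\<Sum>n<N. fps_nth (t n) k)"
        by (intro sum.mono_neutral_left) (auto intro: z)
      thus "fps_nth (sum t {..<N}) k = fps_nth ?s k" by (simp add: fps_sum_nth)
    qed
  qed
  thus ?thesis by (auto simp: summable_def sums_def)
qed

lemma fps_X_dvd_power:
  fixes q :: "'a::comm_ring_1 fps"
  assumes "fps_X dvd q" "n \<le> m" shows "fps_X ^ n dvd q ^ m"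
  using assms by (meson dvd_power_same dvd_trans le_imp_power_dvd)

lemma mock_summable:
  fixes q a b :: "'a::comm_ring_1 fps"
  assumes "fps_X dvd q" "fps_X dvd a"
  shows "summable (\<lambda>n. q ^ (n\<^sup>2 - n) * a ^ n * recip (qpoch (- q) q n * qpoch (- a) q n))"
    and "summable (\<lambda>n. q ^ (n\<^sup>2) * recip (qpoch (- (b * q)) (q\<^sup>2) n))"
    and "summable (\<lambda>n. q ^ ((Suc n)\<^sup>2) * recip (qpoch b (q\<^sup>2) (Suc n)))"
proof -
  have sq: "n \<le> n\<^sup>2" "n \<le> (Suc n)\<^sup>2" for n :: nat
    by (simp_all add: power2_eq_square)
  show "summable (\<lambda>n. q ^ (n\<^sup>2 - n) * a ^ n * recip (qpoch (- q) q n * qpoch (- a) q n))"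
    by (intro fps_summable dvd_mult2 dvd_mult fps_X_dvd_power[OF assms(2)]) simp
  show "summable (\<lambda>n. q ^ (n\<^sup>2) * recip (qpoch (- (b * q)) (q\<^sup>2) n))"
    by (intro fps_summable dvd_mult2 fps_X_dvd_power[OF assms(1)] sq)
  show "summable (\<lambda>n. q ^ ((Suc n)\<^sup>2) * recip (qpoch b (q\<^sup>2) (Suc n)))"
    by (intro fps_summable dvd_mult2 fps_X_dvd_power[OF assms(1)] sq)
qed

lemma finite_partitions_of: "finite {p \<in> partitions. sum_list p = n}"
proof (rule finite_subset)
  show "{p \<in> partitions. sum_list p = n} \<subseteq> {p. set p \<subseteq> {..n} \<and> length p \<le> n}"
  proof safe
    fix p assume p: "p \<in> partitions"
    show "x \<le> sum_list p" if "x \<in> set p" for x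
      using that by (simp add: member_le_sum_list)
    have "\<forall>x\<in>set p. 0 < x" using p by (simp add: partitions_def)
    thus "length p \<le> sum_list p" by (induction p) auto
  qed
qed (simp add: finite_lists_length_le)

lemma partition_sum_summable:
  fixes c :: "nat list \<Rightarrow> 'a::comm_ring_1 fps"
  assumes "A \<subseteq> partitions"
  shows "(\<lambda>p. c p * fps_X ^ sum_list p) summable_on A"
proof -
  let ?g = "\<lambda>p. c p * fps_X ^ sum_list p"
  define F where "F k = {p \<in> A. sum_list p \<le> k}" for k
  have fin: "finite (F k)" for k
  proof (rule finite_subset)
    show "F k \<subseteq> (\<Union>n\<le>k. {p \<in> partitions. sum_list p = n})" using assms by (auto simp: F_def)
  qed (auto intro: finite_partitions_of)
  let ?s = "Abs_fps (\<lambda>k. \<Sum>p\<in>F k. fps_nth (?g p) k)"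
  have "(sum ?g \<longlongrightarrow> ?s) (finite_subsets_at_top A)"
  proof (rule tendsto_fpsI)
    fix k
    show "\<forall>\<^sub>F X in finite_subsets_at_top A. fps_nth (sum ?g X) k = fps_nth ?s k"
      unfolding eventually_finite_subsets_at_top
    proof (intro exI[of _ "F k"] conjI allI impI)
      fix Y assume Y: "finite Y \<and> F k \<subseteq> Y \<and> Y \<subseteq> A"
      hence "(\<Sum>p\<in>F k. fps_nth (?g p) k) = (\<Sum>p\<in>Y. fps_nth (?g p) k)"
        by (intro sum.mono_neutral_left) (auto simp: F_def fps_X_power_mult_right_nth)
      thus "fps_nth (sum ?g Y) k = fps_nth ?s k" by (simp add: fps_sum_nth)
    qed (use fin in \<open>auto simp: F_def\<close>)
  qed
  thus ?thesis by (auto simp: summable_on_def has_sum_def)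
qed

end

theory Submission
  imports Defs
begin

text \<open>
  The \<open>n\<close>-th summand of each series is the generating function of a class of partitions: those with
  Durfee square of side \<open>n\<close> for \<open>f\<close>, those with \<open>n\<close> parts for \<open>\<phi>\<close>, those with largest part
  \<open>2n - 1\<close> for \<open>\<psi>\<close>. Cutting off the Durfee square leaves a partition with at most \<open>n\<close> parts to its
  right, padded with zeros to a list of length \<open>n\<close>, and one with all parts at most \<open>n\<close> below it.
  Every class \<open>A\<^sub>n\<close> that remains satisfies \<open>A\<^sub>n = f(A\<^sub>n) \<union> g(A\<^sub>n\<^sub>-\<^sub>1)\<close>, disjointly, where \<open>f\<close> and \<open>g\<close>
  multiply the weight by fixed monomials \<open>u\<close> and \<open>v\<close>: lower all parts by the same amount or remove
  the smallest possible part, or remove one copy of the largest part. Hence the generating functions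
  satisfy \<open>(1 - u) G\<^sub>n = v G\<^sub>n\<^sub>-\<^sub>1\<close>, which is the recurrence of the \<open>q\<close>-Pochhammer quotients.
\<close>

section \<open>Weighted generating functions\<close>

text \<open>A sum over an infinite fibre is \<open>0\<close> by convention; hence finite fibres are
  assumed below wherever sets are combined.\<close>

definition gen_fun :: "'a set \<Rightarrow> ('a \<Rightarrow> nat) \<Rightarrow> ('a \<Rightarrow> 'b::comm_ring_1) \<Rightarrow> 'b fps" where
  "gen_fun A s c = Abs_fps (\<lambda>k. \<Sum>p | p \<in> A \<and> s p = k. c p)"

lemma gen_fun_nth: "fps_nth (gen_fun A s c) k = (\<Sum>p | p \<in> A \<and> s p = k. c p)"
  by (simp add: gen_fun_def)

lemma gen_fun_cong:
  assumes "\<And>p. p \<in> A \<Longrightarrow> c p = c' p"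
  shows "gen_fun A s c = gen_fun A s c'"
  using assms by (auto simp: gen_fun_def intro!: ext sum.cong)

lemma gen_fun_singleton: "gen_fun {x} s c = fps_const (c x) * fps_X ^ s x"
proof (rule fps_ext)
  fix k
  have "{p. p = x \<and> s p = k} = (if s x = k then {x} else {})" by auto
  thus "fps_nth (gen_fun {x} s c) k = fps_nth (fps_const (c x) * fps_X ^ s x) k"
    by (simp add: gen_fun_nth fps_X_power_mult_right_nth)
qed

text \<open>\<open>f\<close> carries the fibre of size \<open>k - d\<close> bijectively onto that of
  size \<open>k\<close>, and no image has size below \<open>d\<close>.\<close>

lemma gen_fun_image:
  assumes "inj_on f A" "\<And>p. p \<in> A \<Longrightarrow> s' (f p) = s p + d" "\<And>p. p \<in> A \<Longrightarrow> c' (f p) = u * c p"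
  shows "gen_fun (f ` A) s' c' = fps_const u * fps_X ^ d * gen_fun A s c"
proof (rule fps_ext)
  fix k
  have "{p. p \<in> f ` A \<and> s' p = k} = f ` {p. p \<in> A \<and> s p + d = k}"
    using assms(2) by auto
  moreover have "inj_on f {p. p \<in> A \<and> s p + d = k}"
    using assms(1) by (rule inj_on_subset) auto
  ultimately have "fps_nth (gen_fun (f ` A) s' c') k = (\<Sum>p | p \<in> A \<and> s p + d = k. u * c p)"
    using assms(3) by (simp add: gen_fun_nth sum.reindex)
  also have "\<dots> = (if k < d then 0 else u * fps_nth (gen_fun A s c) (k - d))"
  proof -
    have "{p. p \<in> A \<and> s p + d = k} = (if k < d then {} else {p. p \<in> A \<and> s p = k - d})"
      by auto
    thus ?thesis by (auto simp: gen_fun_nth sum_distrib_left)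
  qed
  finally show "fps_nth (gen_fun (f ` A) s' c') k
      = fps_nth (fps_const u * fps_X ^ d * gen_fun A s c) k"
    by (simp add: mult.assoc fps_X_power_mult_nth)
qed

lemma gen_fun_Un:
  assumes "A \<inter> B = {}" "\<And>k. finite {p. p \<in> A \<union> B \<and> s p = k}"
  shows "gen_fun (A \<union> B) s c = gen_fun A s c + gen_fun B s c"
proof (rule fps_ext)
  fix k
  have eq: "{p. p \<in> A \<union> B \<and> s p = k} = {p. p \<in> A \<and> s p = k} \<union> {p. p \<in> B \<and> s p = k}" by auto
  have "finite ({p. p \<in> A \<and> s p = k} \<union> {p. p \<in> B \<and> s p = k})"
    using assms(2)[of k] unfolding eq .
  thus "fps_nth (gen_fun (A \<union> B) s c) k = fps_nth (gen_fun A s c + gen_fun B s c) k"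
    unfolding fps_add_nth gen_fun_nth eq using assms(1) by (intro sum.union_disjoint) auto
qed

text \<open>Cauchy product: the pairs of total size \<open>k\<close> are split by the size
  \<open>i\<close> of the first component.\<close>

lemma gen_fun_Times:
  assumes "\<And>k. finite {p. p \<in> A \<and> s p = k}" "\<And>k. finite {p. p \<in> B \<and> t p = k}"
  shows "gen_fun (A \<times> B) (\<lambda>(x, y). s x + t y) (\<lambda>(x, y). c x * d y)
    = gen_fun A s c * gen_fun B t d"
proof (rule fps_ext)
  fix k
  define S where "S i = {p. p \<in> A \<and> s p = i}" for i
  define T where "T i = {p. p \<in> B \<and> t p = i}" for i
  have fin: "finite (S i)" "finite (T i)" for i
    using assms by (auto simp: S_def T_def)
  have "{p. p \<in> A \<times> B \<and> (\<lambda>(x, y). s x + t y) p = k} = (\<Union>i\<in>{0..k}. S i \<times> T (k - i))"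
    by (auto simp: S_def T_def)
  hence "fps_nth (gen_fun (A \<times> B) (\<lambda>(x, y). s x + t y) (\<lambda>(x, y). c x * d y)) k
      = (\<Sum>p\<in>(\<Union>i\<in>{0..k}. S i \<times> T (k - i)). (\<lambda>(x, y). c x * d y) p)"
    by (simp add: gen_fun_nth)
  also have "\<dots> = (\<Sum>i=0..k. \<Sum>p\<in>S i \<times> T (k - i). (\<lambda>(x, y). c x * d y) p)"
    by (rule sum.UNION_disjoint) (use fin in \<open>auto simp: S_def T_def\<close>)
  also have "\<dots> = (\<Sum>i=0..k. sum c (S i) * sum d (T (k - i)))"
    by (simp add: sum_product sum.cartesian_product)
  finally show "fps_nth (gen_fun (A \<times> B) (\<lambda>(x, y). s x + t y) (\<lambda>(x, y). c x * d y)) k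
      = fps_nth (gen_fun A s c * gen_fun B t d) k"
    by (simp add: fps_mult_nth gen_fun_nth S_def T_def)
qed

text \<open>By \<open>le\<close>, only the sets \<open>A n\<close> with \<open>n\<close> at most
  \<open>k\<close> contribute to the \<open>k\<close>-th coefficient, so the partial sums have their
  final coefficient from \<open>N = Suc k\<close> on.\<close>

lemma gen_fun_UN_sums:
  assumes fin: "\<And>k. finite {p. p \<in> (\<Union>n. A n) \<and> s p = k}"
    and disj: "\<And>m n. m \<noteq> n \<Longrightarrow> A m \<inter> A n = {}"
    and le: "\<And>n p. p \<in> A n \<Longrightarrow> n \<le> s p"
  shows "(\<lambda>n. gen_fun (A n) s c) sums gen_fun (\<Union>n. A n) s c"
  unfolding sums_def
proof (rule tendsto_fpsI)
  fix k
  show "\<forall>\<^sub>F N in sequentially. fps_nth (\<Sum>n<N. gen_fun (A n) s c) k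
      = fps_nth (gen_fun (\<Union>n. A n) s c) k"
  proof (rule eventually_sequentiallyI[of "Suc k"])
    fix N assume N: "Suc k \<le> N"
    have eq: "{p. p \<in> (\<Union>n. A n) \<and> s p = k} = (\<Union>n\<in>{..<N}. {p. p \<in> A n \<and> s p = k})"
      using le N by force
    have "finite {p. p \<in> A n \<and> s p = k}" for n
      using fin[of k] by (rule rev_finite_subset) auto
    hence "(\<Sum>p | p \<in> (\<Union>n. A n) \<and> s p = k. c p) = (\<Sum>n<N. \<Sum>p | p \<in> A n \<and> s p = k. c p)"
      unfolding eq using disj by (intro sum.UNION_disjoint) auto
    thus "fps_nth (\<Sum>n<N. gen_fun (A n) s c) k = fps_nth (gen_fun (\<Union>n. A n) s c) k"
      by (simp add: fps_sum_nth gen_fun_nth)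
  qed
qed

text \<open>Links the unordered sums of the theorem to generating functions: any finite subset of
  \<open>A\<close> containing the fibre of size \<open>k\<close> already yields the final
  \<open>k\<close>-th coefficient.\<close>

lemma infsum_gen_fun:
  assumes "\<And>k. finite {p. p \<in> A \<and> s p = k}"
  shows "(\<Sum>\<^sub>\<infinity>p\<in>A. fps_const (c p) * fps_X ^ s p) = gen_fun A s c"
proof (rule infsumI, unfold has_sum_def, rule tendsto_fpsI)
  fix k
  show "\<forall>\<^sub>F F in finite_subsets_at_top A.
      fps_nth (\<Sum>p\<in>F. fps_const (c p) * fps_X ^ s p) k = fps_nth (gen_fun A s c) k"
    unfolding eventually_finite_subsets_at_top
  proof (intro exI[of _ "{p. p \<in> A \<and> s p = k}"] conjI allI impI)
    fix Y assume Y: "finite Y \<and> {p. p \<in> A \<and> s p = k} \<subseteq> Y \<and> Y \<subseteq> A"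
    have "(\<Sum>p\<in>Y. if s p = k then c p else 0) = (\<Sum>p | p \<in> A \<and> s p = k. c p)"
      using Y by (intro sum.mono_neutral_cong_right) auto
    moreover have "fps_nth (\<Sum>p\<in>Y. fps_const (c p) * fps_X ^ s p) k
        = (\<Sum>p\<in>Y. if s p = k then c p else 0)"
      unfolding fps_sum_nth by (intro sum.cong) (auto simp: fps_X_power_mult_right_nth)
    ultimately show "fps_nth (\<Sum>p\<in>Y. fps_const (c p) * fps_X ^ s p) k
        = fps_nth (gen_fun A s c) k"
      by (simp add: gen_fun_nth)
  qed (use assms in auto)
qed

text \<open>\<open>A'\<close> occurs on both sides of the decomposition, so its own series returns
  with the monomial belonging to \<open>f\<close> as a factor and is moved to the left.\<close>

lemma gen_fun_recurrence:
  assumes split: "A' = f ` A' \<union> g ` A" "f ` A' \<inter> g ` A = {}"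
    and inj: "inj_on f A'" "inj_on g A"
    and fin: "\<And>k. finite {p. p \<in> A' \<and> s p = k}"
    and f: "\<And>p. p \<in> A' \<Longrightarrow> s (f p) = s p + d" "\<And>p. p \<in> A' \<Longrightarrow> c (f p) = u * c p"
    and g: "\<And>p. p \<in> A \<Longrightarrow> s (g p) = s p + e" "\<And>p. p \<in> A \<Longrightarrow> c (g p) = v * c p"
  shows "(1 - fps_const u * fps_X ^ d) * gen_fun A' s c = fps_const v * fps_X ^ e * gen_fun A s c"
proof -
  have "gen_fun A' s c = gen_fun (f ` A' \<union> g ` A) s c"
    using split(1) by (rule arg_cong)
  also have "\<dots> = gen_fun (f ` A') s c + gen_fun (g ` A) s c"
    by (rule gen_fun_Un[OF split(2)]) (unfold split(1)[symmetric], rule fin)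
  also have "gen_fun (f ` A') s c = fps_const u * fps_X ^ d * gen_fun A' s c"
    by (rule gen_fun_image) (simp_all add: inj f)
  also have "gen_fun (g ` A) s c = fps_const v * fps_X ^ e * gen_fun A s c"
    by (rule gen_fun_image) (simp_all add: inj g)
  finally show ?thesis
    unfolding left_diff_distrib mult_1 diff_eq_eq by (rule trans[OF _ add.commute])
qed

section \<open>Pochhammer products and reciprocals\<close>

lemma qpoch_Suc: "qpoch a q (Suc n) = qpoch a q n * (1 - a * q ^ n)"
  by (simp add: qpoch_def)

lemma recip_mult:
  fixes x y :: "'a::comm_ring_1 fps"
  assumes "fps_nth x 0 = 1" "fps_nth y 0 = 1"
  shows "recip (x * y) = recip x * recip y"
proof (rule recip_eqI)
  have "x * y * (recip x * recip y) = (x * recip x) * (y * recip y)" by (simp add: mult_ac)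
  thus "x * y * (recip x * recip y) = 1" using assms by (simp add: mult_recip)
qed

lemma eq_mult_recip:
  fixes x y z :: "'a::comm_ring_1 fps"
  assumes "x * y = z" "fps_nth x 0 = 1"
  shows "y = z * recip x"
proof -
  have "z * recip x = y * (x * recip x)" using assms(1) by (auto simp: mult_ac)
  thus ?thesis using assms(2) by (simp add: mult_recip)
qed

section \<open>Families of partitions\<close>

text \<open>\<open>hd []\<close> is unspecified; the value \<open>0\<close> gives the empty
  partition weight \<open>1\<close>.\<close>

definition largest :: "nat list \<Rightarrow> nat" where
  "largest p = (if p = [] then 0 else hd p)"

lemma largest_append: "p \<noteq> [] \<Longrightarrow> largest (p @ p') = largest p"
  by (simp add: largest_def)

lemma largest_map: "p \<noteq> [] \<Longrightarrow> largest (map f p) = f (largest p)"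
  by (simp add: largest_def hd_map)

lemma sorted_wrt_map_add: "sorted_wrt (\<ge>) (map ((+) n) p) \<longleftrightarrow> sorted_wrt (\<ge>) (p :: nat list)"
  by (simp add: sorted_wrt_map)

lemma sum_list_map_add: "sum_list (map ((+) d) p) = d * length p + sum_list p" for d :: nat
  by (induction p) auto

lemma map_diff_add:
  fixes d :: nat
  assumes "\<forall>x\<in>set p. d \<le> x"
  shows "map ((+) d) (map (\<lambda>x. x - d) p) = p"
  using assms by (induction p) auto

text \<open>Every entry of the shifted list is at least \<open>d\<close>. This separates the two
  images in the recurrences that append a smallest part.\<close>

lemma map_add_neq_snoc:
  fixes d e :: nat
  assumes "e < d"
  shows "map ((+) d) p \<noteq> p' @ [e]"
proof
  assume "map ((+) d) p = p' @ [e]"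
  hence "e \<in> set (map ((+) d) p)" by simp
  thus False using assms by auto
qed

lemma length_le_sum_list:
  fixes p :: "nat list"
  assumes "\<forall>x\<in>set p. 0 < x"
  shows "length p \<le> sum_list p"
  using assms by (induction p) auto

lemma finite_fibre:
  assumes "A \<subseteq> insert [] partitions"
  shows "finite {p. p \<in> A \<and> sum_list p = k}"
proof (rule finite_subset)
  show "{p. p \<in> A \<and> sum_list p = k} \<subseteq> insert [] {p \<in> partitions. sum_list p = k}"
    using assms by auto
qed (simp add: finite_partitions_of)

text \<open>The empty partition accounts for the leading \<open>1\<close> in the identities for f
  and phi.\<close>

lemma gen_fun_insert_Nil:
  assumes "A \<subseteq> partitions" "c [] = 1"
  shows "gen_fun (insert [] A) sum_list c = 1 + gen_fun A sum_list c"
proof -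
  have "gen_fun ({[]} \<union> A) sum_list c = gen_fun {[]} sum_list c + gen_fun A sum_list c"
    using assms(1) by (intro gen_fun_Un finite_fibre) (auto simp: partitions_def)
  thus ?thesis using assms(2) by (simp add: gen_fun_singleton)
qed

section \<open>Partitions with at most n parts\<close>

definition padded :: "nat \<Rightarrow> nat list set" where
  "padded n = {p. length p = n \<and> sorted_wrt (\<ge>) p}"

text \<open>Lists with zero entries lie outside \<open>partitions\<close>, so finiteness comes from
  the fixed length instead.\<close>

lemma finite_fibre_padded: "finite {p. p \<in> padded n \<and> sum_list p = k}"
proof (rule finite_subset)
  show "{p. p \<in> padded n \<and> sum_list p = k} \<subseteq> {p. set p \<subseteq> {..k} \<and> length p = n}"
    by (auto simp: padded_def member_le_sum_list)
qed (simp add: finite_lists_length_eq)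

text \<open>Split on whether the last, hence smallest, entry is zero. If it is positive, all entries
  are, and each can be lowered by one.\<close>

lemma padded_Suc: "padded (Suc n) = map ((+) 1) ` padded (Suc n) \<union> (\<lambda>p. p @ [0]) ` padded n"
proof (intro equalityI subsetI)
  fix p assume p: "p \<in> padded (Suc n)"
  then obtain r x where r: "p = r @ [x]" "length r = n"
    by (cases p rule: rev_cases) (auto simp: padded_def)
  show "p \<in> map ((+) 1) ` padded (Suc n) \<union> (\<lambda>p. p @ [0]) ` padded n"
  proof (cases "x = 0")
    case True
    thus ?thesis using p r by (auto simp: padded_def sorted_wrt_append)
  next
    case False
    hence "\<forall>x\<in>set p. 1 \<le> x" using p r by (auto simp: padded_def sorted_wrt_append)
    hence eq: "map ((+) 1) (map (\<lambda>x. x - 1) p) = p" by (rule map_diff_add)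
    have "map (\<lambda>x. x - 1) p \<in> padded (Suc n)"
      using p sorted_wrt_map_add[of 1 "map (\<lambda>x. x - 1) p"] unfolding eq by (simp add: padded_def)
    thus ?thesis using eq by (metis UnI1 imageI)
  qed
qed (auto simp: padded_def sorted_wrt_append sorted_wrt_map)

lemma gen_fun_padded:
  fixes a :: "'a::comm_ring_1"
  shows "gen_fun (padded n) sum_list (\<lambda>p. (- a) ^ largest p)
    = recip (qpoch (- (fps_const a * fps_X)) fps_X n)"
proof -
  let ?G = "\<lambda>n. gen_fun (padded n) sum_list (\<lambda>p. (- a) ^ largest p)"
  have "qpoch (- (fps_const a * fps_X)) fps_X n * ?G n = 1"
  proof (induction n)
    case 0
    have "padded 0 = {[]}" by (auto simp: padded_def)
    thus ?case by (simp add: gen_fun_singleton qpoch_def largest_def)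
  next
    case (Suc n)
    have "(1 - fps_const (- a) * fps_X ^ Suc n) * ?G (Suc n) = fps_const 1 * fps_X ^ 0 * ?G n"
    proof (rule gen_fun_recurrence[OF padded_Suc])
      show "map ((+) 1) ` padded (Suc n) \<inter> (\<lambda>p. p @ [0]) ` padded n = {}"
        using map_add_neq_snoc[OF zero_less_one] by blast
    next
      fix p assume p: "p \<in> padded (Suc n)"
      hence "p \<noteq> []" "length p = Suc n" by (auto simp: padded_def)
      thus "(- a) ^ largest (map ((+) 1) p) = - a * (- a) ^ largest p"
        "sum_list (map ((+) 1) p) = sum_list p + Suc n"
        by (simp_all add: largest_map sum_list_map_add)
    next
      fix p assume "p \<in> padded n"
      \<comment> \<open>For empty \<open>p\<close> the appended \<open>0\<close> becomes the head,
        in agreement with \<open>largest [] = 0\<close>.\<close>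
      show "(- a) ^ largest (p @ [0]) = 1 * (- a) ^ largest p"
        by (cases p) (simp_all add: largest_def)
    qed (auto simp: finite_fibre_padded inj_on_def)
    hence "(1 + fps_const a * fps_X ^ Suc n) * ?G (Suc n) = ?G n"
      by (simp flip: fps_const_neg)
    thus ?case using Suc.IH by (simp add: qpoch_Suc mult_ac)
  qed
  thus ?thesis by (rule recip_eqI[symmetric])
qed

section \<open>Partitions with all parts at most n\<close>

definition bounded_parts :: "nat \<Rightarrow> nat list set" where
  "bounded_parts n = {p. sorted_wrt (\<ge>) p \<and> set p \<subseteq> {1..n}}"

lemma bounded_parts_subset: "bounded_parts n \<subseteq> insert [] partitions"
  by (auto simp: bounded_parts_def partitions_def)

text \<open>Split on whether the head is \<open>Suc n\<close>; if not, no part is, as the list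
  decreases. \<open>id\<close> puts the second family into the shape of
  \<open>gen_fun_recurrence\<close>.\<close>

lemma bounded_parts_Suc:
  "bounded_parts (Suc n) = Cons (Suc n) ` bounded_parts (Suc n) \<union> id ` bounded_parts n"
proof (intro equalityI subsetI)
  fix p assume p: "p \<in> bounded_parts (Suc n)"
  show "p \<in> Cons (Suc n) ` bounded_parts (Suc n) \<union> id ` bounded_parts n"
  proof (cases p)
    case Nil
    thus ?thesis by (simp add: bounded_parts_def)
  next
    case (Cons x r)
    show ?thesis
    proof (cases "x = Suc n")
      case True
      thus ?thesis using p Cons by (auto simp: bounded_parts_def)
    next
      case False
      hence "x \<le> n" using p Cons by (auto simp: bounded_parts_def)
      hence "p \<in> bounded_parts n" using p Cons by (fastforce simp: bounded_parts_def)
      thus ?thesis by simp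
    qed
  qed
qed (force simp: bounded_parts_def)+

lemma gen_fun_bounded_parts:
  "gen_fun (bounded_parts n) sum_list (\<lambda>p. (- 1) ^ length p)
    = recip (qpoch (- fps_X) fps_X n :: 'a::comm_ring_1 fps)"
proof -
  let ?G = "\<lambda>n. gen_fun (bounded_parts n) sum_list (\<lambda>p. (- 1) ^ length p) :: 'a fps"
  have "qpoch (- fps_X) fps_X n * ?G n = 1"
  proof (induction n)
    case 0
    have "bounded_parts 0 = {[]}" by (auto simp: bounded_parts_def)
    thus ?case by (simp add: gen_fun_singleton qpoch_def)
  next
    case (Suc n)
    have "(1 - fps_const (- 1) * fps_X ^ Suc n) * ?G (Suc n) = fps_const 1 * fps_X ^ 0 * ?G n"
      by (rule gen_fun_recurrence[OF bounded_parts_Suc _ _ _ finite_fibre[OF bounded_parts_subset]])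
        (auto simp: bounded_parts_def)
    hence "(1 + fps_X ^ Suc n) * ?G (Suc n) = ?G n"
      by (simp flip: fps_const_neg)
    thus ?case using Suc.IH by (simp add: qpoch_Suc mult_ac)
  qed
  thus ?thesis by (rule recip_eqI[symmetric])
qed

section \<open>Partitions and Durfee squares\<close>

text \<open>In the Ferrers diagram, \<open>xs\<close> lies to the right of the square of side
  \<open>n\<close> and \<open>ys\<close> below it.\<close>

definition glue :: "nat \<Rightarrow> nat list \<times> nat list \<Rightarrow> nat list" where
  "glue n = (\<lambda>(xs, ys). map ((+) n) xs @ ys)"

text \<open>The condition on \<open>take\<close> says that the square of side \<open>n\<close> fits
  into the diagram, the one on \<open>drop\<close> that no larger square does.\<close>

definition durfee :: "nat \<Rightarrow> nat list set" where
  "durfee n = {p. sorted_wrt (\<ge>) p \<and> (\<forall>x\<in>set p. 0 < x) \<and> n \<le> length p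
     \<and> (\<forall>x\<in>set (take n p). n \<le> x) \<and> (\<forall>x\<in>set (drop n p). x \<le> n)}"

lemma durfee_eq: "durfee n = glue n ` (padded n \<times> bounded_parts n)"
proof (intro equalityI subsetI)
  fix p assume p: "p \<in> durfee n"
  let ?xs = "map (\<lambda>x. x - n) (take n p)"
  have eq: "map ((+) n) ?xs = take n p"
    using p by (intro map_diff_add) (auto simp: durfee_def)
  have "sorted_wrt (\<ge>) (take n p)" "sorted_wrt (\<ge>) (drop n p)"
    using p by (auto simp: durfee_def sorted_wrt_take sorted_wrt_drop)
  moreover have "set (drop n p) \<subseteq> {1..n}"
    using p by (force simp: durfee_def dest: in_set_dropD)
  ultimately have "?xs \<in> padded n" "drop n p \<in> bounded_parts n"
    using p sorted_wrt_map_add[of n ?xs] unfolding eq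
    by (auto simp: padded_def bounded_parts_def durfee_def)
  moreover have "p = glue n (?xs, drop n p)" unfolding glue_def prod.case eq by simp
  ultimately show "p \<in> glue n ` (padded n \<times> bounded_parts n)" by blast
next
  fix p assume "p \<in> glue n ` (padded n \<times> bounded_parts n)"
  then obtain xs ys where *: "xs \<in> padded n" "ys \<in> bounded_parts n" "p = map ((+) n) xs @ ys"
    by (auto simp: glue_def)
  \<comment> \<open>Makes the shifted entries positive although \<open>xs\<close> may contain zeros:
    a nonempty \<open>xs\<close> has length \<open>n\<close>.\<close>
  have "0 < n" if "x \<in> set xs" for x
    using * that by (auto simp: padded_def)
  with * show "p \<in> durfee n"
    by (auto simp: durfee_def padded_def bounded_parts_def sorted_wrt_append sorted_wrt_map_add
        intro: trans_le_add1)
qed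

lemma durfee_UN: "(\<Union>n. durfee n) = insert [] partitions"
proof (intro equalityI subsetI)
  fix p assume p: "p \<in> insert [] partitions"
  hence sorted: "sorted_wrt (\<ge>) p" and pos: "\<forall>x\<in>set p. 0 < x" by (auto simp: partitions_def)
  have mono: "p ! j \<le> p ! i" if "i \<le> j" "j < length p" for i j
    using sorted that by (cases "i = j") (auto simp: sorted_wrt_iff_nth_less)
  \<comment> \<open>Counting from 0, \<open>p ! n\<close> is the part just below a square of side
    \<open>n\<close>; the Durfee side is the first \<open>n\<close> for which this part is missing
    or at most \<open>n\<close>.\<close>
  define n where "n = (LEAST n. length p \<le> n \<or> p ! n \<le> n)"
  have n: "length p \<le> n \<or> p ! n \<le> n"
    unfolding n_def by (rule LeastI[of _ "length p"]) simp
  have before: "i < length p \<and> i < p ! i" if "i < n" for i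
    using not_less_Least[of i "\<lambda>n. length p \<le> n \<or> p ! n \<le> n"] that by (simp add: n_def)
  have len: "n \<le> length p"
    using before[of "n - 1"] by (cases n) auto
  have "n \<le> x" if x: "x \<in> set (take n p)" for x
  proof -
    obtain i where i: "i < n" "x = p ! i"
      using x len by (auto simp: in_set_conv_nth)
    \<comment> \<open>Row \<open>n - 1\<close> is the last one in the square; its part is at least
      \<open>n\<close>, and the earlier parts are no smaller.\<close>
    have "n - 1 < length p \<and> n - 1 < p ! (n - 1)" using before i by simp
    moreover have "p ! (n - 1) \<le> p ! i" using i len by (intro mono) auto
    ultimately show ?thesis using i by linarith
  qed
  moreover have "x \<le> n" if x: "x \<in> set (drop n p)" for x
  proof -
    obtain i where "i < length (drop n p)" "x = drop n p ! i"
      using x by (metis in_set_conv_nth)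
    hence i: "n + i < length p" "x = p ! (n + i)"
      using len by auto
    have "p ! (n + i) \<le> p ! n" using i by (intro mono) auto
    thus ?thesis using n i by linarith
  qed
  ultimately have "p \<in> durfee n" using sorted pos len by (auto simp: durfee_def)
  thus "p \<in> (\<Union>n. durfee n)" by blast
qed (auto simp: durfee_def partitions_def)

text \<open>If \<open>m < n\<close>, the entry \<open>p ! m\<close> lies below the square of side
  \<open>m\<close> and in a row of the square of side \<open>n\<close>, so it would be both at most
  \<open>m\<close> and at least \<open>n\<close>.\<close>

lemma durfee_disjoint:
  assumes "m \<noteq> n"
  shows "durfee m \<inter> durfee n = {}"
proof -
  have False if "m < n" "p \<in> durfee m" "p \<in> durfee n" for m n p
  proof -
    have "m < length p" using that by (auto simp: durfee_def)
    hence "p ! m \<in> set (drop m p)" "p ! m \<in> set (take n p)"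
      using that(1) nth_mem[of 0 "drop m p"] nth_mem[of m "take n p"] by simp_all
    hence "p ! m \<le> m" "n \<le> p ! m" using that(2,3) unfolding durfee_def by blast+
    thus False using that(1) by linarith
  qed
  thus ?thesis using assms by (metis disjoint_iff linorder_neqE_nat)
qed

text \<open>The square adds \<open>n\<close> to the largest part and \<open>n\<close> to the number
  of parts, so its own sign is trivial. The remaining sign splits between \<open>xs\<close>, where
  it turns \<open>a\<close> into \<open>- a\<close>, and \<open>ys\<close>.\<close>

lemma gen_fun_durfee:
  fixes a :: "'a::comm_ring_1"
  shows "gen_fun (durfee n) sum_list (\<lambda>p. (- 1) ^ (largest p + length p) * a ^ largest p)
    = fps_X ^ (n\<^sup>2 - n) * (fps_const a * fps_X) ^ n
      * recip (qpoch (- fps_X) fps_X n * qpoch (- (fps_const a * fps_X)) fps_X n)"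
proof -
  have "gen_fun (durfee n) sum_list (\<lambda>p. (- 1) ^ (largest p + length p) * a ^ largest p)
      = fps_const (a ^ n) * fps_X ^ n\<^sup>2 * gen_fun (padded n \<times> bounded_parts n)
          (\<lambda>(xs, ys). sum_list xs + sum_list ys)
          (\<lambda>(xs, ys). (- a) ^ largest xs * (- 1) ^ length ys)"
    unfolding durfee_eq
  proof (rule gen_fun_image)
    show "inj_on (glue n) (padded n \<times> bounded_parts n)"
      by (auto simp: inj_on_def glue_def padded_def)
  next
    fix z assume "z \<in> padded n \<times> bounded_parts n"
    then obtain xs ys where z: "z = (xs, ys)" "xs \<in> padded n" "ys \<in> bounded_parts n" by blast
    show "sum_list (glue n z) = (case z of (xs, ys) \<Rightarrow> sum_list xs + sum_list ys) + n\<^sup>2"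
      using z by (simp add: glue_def sum_list_map_add padded_def power2_eq_square)
    have largest: "largest (glue n z) = n + largest xs"
    \<comment> \<open>For \<open>n = 0\<close> the head could only come from \<open>ys\<close>, but
      then both lists are empty.\<close>
    proof (cases "n = 0")
      case True
      thus ?thesis using z by (simp add: glue_def padded_def bounded_parts_def largest_def)
    next
      case False
      hence "xs \<noteq> []" using z by (auto simp: padded_def)
      thus ?thesis using z by (simp add: glue_def largest_append largest_map)
    qed
    have "length (glue n z) = n + length ys"
      using z by (simp add: glue_def padded_def)
    thus "(- 1) ^ (largest (glue n z) + length (glue n z)) * a ^ largest (glue n z)
        = a ^ n * (case z of (xs, ys) \<Rightarrow> (- a) ^ largest xs * (- 1) ^ length ys)"
      unfolding largest power_minus[of a] using z by (simp add: power_add mult_ac)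
  qed
  also have "\<dots> = fps_const (a ^ n) * fps_X ^ n\<^sup>2 *
      (recip (qpoch (- (fps_const a * fps_X)) fps_X n) * recip (qpoch (- fps_X) fps_X n))"
    by (subst gen_fun_Times)
      (simp_all add: finite_fibre_padded finite_fibre[OF bounded_parts_subset]
        gen_fun_padded gen_fun_bounded_parts)
  also have "fps_const (a ^ n) * fps_X ^ n\<^sup>2 = fps_X ^ (n\<^sup>2 - n) * (fps_const a * fps_X) ^ n"
  proof -
    have "n\<^sup>2 = (n\<^sup>2 - n) + n" by (simp add: power2_eq_square)
    hence "fps_X ^ n\<^sup>2 = (fps_X ^ (n\<^sup>2 - n) * fps_X ^ n :: 'a fps)" by (metis power_add)
    thus ?thesis by (simp add: power_mult_distrib fps_const_power mult_ac)
  qed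
  finally show ?thesis
    by (simp add: recip_mult qpoch_nth_0 mult_ac)
qed

text \<open>Turns the summands of the theorem, written in the power series ring, into the form
  expected by \<open>infsum_gen_fun\<close>.\<close>

lemma sign_times_power_eq_fps_const:
  "(- 1) ^ i * fps_const a ^ j = fps_const ((- 1) ^ i * a ^ j :: 'a::comm_ring_1)"
proof -
  have "(- 1) ^ i = fps_const ((- 1) ^ i :: 'a)"
    by (metis fps_const_1_eq_1 fps_const_neg fps_const_power)
  thus ?thesis by (simp only: fps_const_power fps_const_mult)
qed

text \<open>The difference and the sum of two integers have the same parity.\<close>

lemma rank_sign_eq:
  assumes "p \<noteq> []"
  shows "rank_sign p = (- 1) ^ (largest p + length p)"
proof -
  have "even (nat \<bar>rank p\<bar>) \<longleftrightarrow> even (largest p + length p)"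
    using assms by (simp add: rank_def largest_def even_nat_iff)
  thus ?thesis by (simp add: rank_sign_def minus_one_power_iff)
qed

lemma mock_f_eq:
  fixes a :: "'a::comm_ring_1"
  shows "mock_f (fps_const a * fps_X) fps_X
    = 1 + (\<Sum>\<^sub>\<infinity>p\<in>partitions. rank_sign p * fps_const a ^ hd p * fps_X ^ sum_list p)"
proof -
  let ?c = "\<lambda>p. (- 1) ^ (largest p + length p) * a ^ largest p"
  have "(\<Sum>\<^sub>\<infinity>p\<in>partitions. rank_sign p * fps_const a ^ hd p * fps_X ^ sum_list p)
      = (\<Sum>\<^sub>\<infinity>p\<in>partitions. fps_const (?c p) * fps_X ^ sum_list p)"
  proof (rule infsum_cong)
    fix p assume "p \<in> partitions"
    hence "p \<noteq> []" by (simp add: partitions_def)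
    thus "rank_sign p * fps_const a ^ hd p * fps_X ^ sum_list p
        = fps_const (?c p) * fps_X ^ sum_list p"
      by (simp add: rank_sign_eq sign_times_power_eq_fps_const largest_def del: fps_const_power)
  qed
  also have "\<dots> = gen_fun partitions sum_list ?c"
    by (intro infsum_gen_fun finite_fibre) auto
  finally have "1 + (\<Sum>\<^sub>\<infinity>p\<in>partitions. rank_sign p * fps_const a ^ hd p * fps_X ^ sum_list p)
      = gen_fun (\<Union>n. durfee n) sum_list ?c"
    by (simp add: gen_fun_insert_Nil durfee_UN largest_def)
  moreover have "(\<lambda>n. gen_fun (durfee n) sum_list ?c) sums gen_fun (\<Union>n. durfee n) sum_list ?c"
  proof (rule gen_fun_UN_sums[OF _ durfee_disjoint])
    fix n p assume "p \<in> durfee n"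
    hence "n \<le> length p" "length p \<le> sum_list p"
      by (auto simp: durfee_def intro: length_le_sum_list)
    thus "n \<le> sum_list p" by linarith
  qed (unfold durfee_UN, rule finite_fibre, rule order.refl)
  ultimately show ?thesis
    by (simp add: mock_f_def gen_fun_durfee sums_iff)
qed

section \<open>Distinct odd parts\<close>

definition DO_length :: "nat \<Rightarrow> nat list set" where
  "DO_length n = {p. length p = n \<and> sorted_wrt (>) p \<and> (\<forall>x\<in>set p. odd x)}"

lemma DO_length_UN: "(\<Union>n. DO_length n) = insert [] partitions_DO"
proof -
  have "sorted_wrt (>) p \<longleftrightarrow> sorted_wrt (\<ge>) p \<and> distinct p" for p :: "nat list"
    by (induction p) (auto simp: order.strict_iff_order)
  thus ?thesis
    by (auto simp: DO_length_def partitions_DO_def partitions_def odd_pos)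
qed

lemma DO_length_subset: "DO_length n \<subseteq> insert [] partitions"
  using DO_length_UN by (auto simp: partitions_DO_def)

text \<open>Split on whether the smallest part is 1. If it is, that part is removed; in both cases
  the remaining parts are at least 3 and are lowered by 2, which keeps them odd.\<close>

lemma DO_length_Suc:
  "DO_length (Suc n) = map ((+) 2) ` DO_length (Suc n) \<union> (\<lambda>p. map ((+) 2) p @ [1]) ` DO_length n"
proof (intro equalityI subsetI)
  have shift: "map (\<lambda>x. x - 2) r \<in> DO_length m \<and> map ((+) 2) (map (\<lambda>x. x - 2) r) = r"
    if "r \<in> DO_length m" "\<forall>x\<in>set r. 1 < x" for r m
  proof -
    have eq: "map ((+) 2) (map (\<lambda>x. x - 2) r) = r"
      using that by (intro map_diff_add) auto
    have "sorted_wrt (>) (map ((+) 2) (map (\<lambda>x. x - 2) r))"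
      using that unfolding eq by (simp add: DO_length_def)
    hence "sorted_wrt (>) (map (\<lambda>x. x - 2) r)"
      unfolding sorted_wrt_map[of _ "(+) 2"] by simp
    moreover have "odd (x - 2)" if "x \<in> set r" for x
    proof -
      have "odd x" "1 < x"
        using \<open>r \<in> DO_length m\<close> \<open>\<forall>x\<in>set r. 1 < x\<close> that by (simp_all add: DO_length_def)
      thus ?thesis by presburger
    qed
    moreover have "length r = m" using that(1) by (simp add: DO_length_def)
    ultimately have "map (\<lambda>x. x - 2) r \<in> DO_length m" by (simp add: DO_length_def)
    thus ?thesis using eq by (rule conjI)
  qed
  fix p assume p: "p \<in> DO_length (Suc n)"
  then obtain r x where r: "p = r @ [x]" "length r = n"
    by (cases p rule: rev_cases) (auto simp: DO_length_def)
  have x: "odd x" "\<forall>y\<in>set r. x < y" "r \<in> DO_length n"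
    using p r by (auto simp: DO_length_def sorted_wrt_append)
  show "p \<in> map ((+) 2) ` DO_length (Suc n) \<union> (\<lambda>p. map ((+) 2) p @ [1]) ` DO_length n"
  proof (cases "x = 1")
    case True
    hence "\<forall>y\<in>set r. 1 < y" using x(2) by blast
    note sh = shift[OF x(3) this]
    hence "map ((+) 2) (map (\<lambda>x. x - 2) r) @ [1] \<in> (\<lambda>p. map ((+) 2) p @ [1]) ` DO_length n"
      by blast
    thus ?thesis unfolding conjunct2[OF sh] r(1) True by blast
  next
    case False
    hence "1 < x" using x(1) by (cases x) auto
    hence "\<forall>y\<in>set p. 1 < y" using x r by auto
    note sh = shift[OF p this]
    hence "map ((+) 2) (map (\<lambda>x. x - 2) p) \<in> map ((+) 2) ` DO_length (Suc n)"
      by blast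
    thus ?thesis unfolding conjunct2[OF sh] by blast
  qed
next
  fix p assume "p \<in> map ((+) 2) ` DO_length (Suc n) \<union> (\<lambda>p. map ((+) 2) p @ [1]) ` DO_length n"
  then consider r where "r \<in> DO_length (Suc n)" "p = map ((+) 2) r"
    | r where "r \<in> DO_length n" "p = map ((+) 2) r @ [1]"
    by blast
  thus "p \<in> DO_length (Suc n)"
    by cases (simp_all add: DO_length_def sorted_wrt_append sorted_wrt_map)
qed

lemma DO_length_Suc_disjoint:
  "map ((+) 2) ` DO_length (Suc n) \<inter> (\<lambda>p. map ((+) 2) p @ [1]) ` DO_length n = {}"
proof -
  have "map ((+) 2) p \<noteq> map ((+) 2) p' @ [1]" for p p' :: "nat list"
    by (rule map_add_neq_snoc) simp
  thus ?thesis by (auto simp del: One_nat_def)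
qed

text \<open>Raising all parts by 2 increases \<open>(largest p + 1) div 2\<close> alone and yields
  the factor \<open>- a\<close>; appending a 1 as well increases the length too and yields only the
  sign.\<close>

lemma gen_fun_DO_length:
  fixes a :: "'a::comm_ring_1"
  defines "c \<equiv> \<lambda>p. (- 1) ^ ((largest p + 1) div 2) * a ^ ((largest p + 1) div 2 - length p)"
  shows "gen_fun (DO_length n) sum_list c
    = (- fps_X) ^ n\<^sup>2 * recip (qpoch (- (fps_const a * fps_X\<^sup>2)) (fps_X\<^sup>2) n)"
proof -
  let ?G = "\<lambda>n. gen_fun (DO_length n) sum_list c"
  have "qpoch (- (fps_const a * fps_X\<^sup>2)) (fps_X\<^sup>2) n * ?G n = (- fps_X) ^ n\<^sup>2"
  proof (induction n)
    case 0
    have "DO_length 0 = {[]}" by (auto simp: DO_length_def)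
    thus ?case by (simp add: gen_fun_singleton qpoch_def largest_def c_def)
  next
    case (Suc n)
    have "(1 - fps_const (- a) * fps_X ^ (2 * Suc n)) * ?G (Suc n)
        = fps_const (- 1) * fps_X ^ (2 * n + 1) * ?G n"
    proof (rule gen_fun_recurrence[OF DO_length_Suc DO_length_Suc_disjoint
        _ _ finite_fibre[OF DO_length_subset]])
      fix p assume p: "p \<in> DO_length (Suc n)"
      hence len: "length p = Suc n" unfolding DO_length_def by blast
      hence ne: "p \<noteq> []" by (cases p) simp_all
      show "sum_list (map ((+) 2) p) = sum_list p + 2 * Suc n"
        using len by (simp add: sum_list_map_add)
      have "p \<in> insert [] partitions_DO" unfolding DO_length_UN[symmetric] using p by blast
      hence "p \<in> partitions_DO" using ne by blast
      \<comment> \<open>Makes the truncated subtraction exact, so that the exponent of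
        \<open>a\<close> really grows by one.\<close>
      hence "length p \<le> (largest p + 1) div 2"
        using length_le_DO ne by (simp add: largest_def)
      hence "(2 + largest p + 1) div 2 - length p = Suc ((largest p + 1) div 2 - length p)"
        by simp
      thus "c (map ((+) 2) p) = - a * c p"
        unfolding c_def using ne by (simp add: largest_map)
    next
      fix p assume p: "p \<in> DO_length n"
      show "sum_list (map ((+) 2) p @ [1]) = sum_list p + (2 * n + 1)"
        using p by (simp add: sum_list_map_add DO_length_def)
      \<comment> \<open>For \<open>p = []\<close> the largest part rises only from 0 to 1, but
        \<open>(largest p + 1) div 2\<close> still rises from 0 to 1.\<close>
      have "largest (map ((+) 2) p @ [1]) + 1 = 2 + (largest p + 1) \<or> p = []"
        by (auto simp: largest_append largest_map)
      thus "c (map ((+) 2) p @ [1]) = - 1 * c p"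
        by (auto simp: c_def largest_def)
    qed (auto simp: inj_on_def)
    \<comment> \<open>The sign is absorbed since the exponent \<open>2 * n + 1\<close> is odd; these
      exponents add up to the square in the numerator.\<close>
    hence rec: "(1 + fps_const a * fps_X ^ (2 * Suc n)) * ?G (Suc n) = (- fps_X) ^ (2 * n + 1) * ?G n"
      by (simp flip: fps_const_neg)
    have pow: "fps_X ^ (2 * Suc n) = (fps_X\<^sup>2 * (fps_X\<^sup>2) ^ n :: 'a fps)"
      by (simp only: power_mult power_Suc)
    have "qpoch (- (fps_const a * fps_X\<^sup>2)) (fps_X\<^sup>2) (Suc n) * ?G (Suc n)
        = qpoch (- (fps_const a * fps_X\<^sup>2)) (fps_X\<^sup>2) n
          * ((1 + fps_const a * fps_X ^ (2 * Suc n)) * ?G (Suc n))"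
      unfolding qpoch_Suc pow by (simp add: mult_ac)
    also have "\<dots> = (- fps_X) ^ (2 * n + 1) * (- fps_X) ^ n\<^sup>2"
      unfolding rec Suc.IH[symmetric] by (rule mult.left_commute)
    also have "\<dots> = (- fps_X) ^ (2 * n + 1 + n\<^sup>2)"
      by (simp only: power_add)
    also have "2 * n + 1 + n\<^sup>2 = (Suc n)\<^sup>2"
      by (simp add: power2_eq_square)
    finally show ?case .
  qed
  thus ?thesis by (rule eq_mult_recip) (simp add: qpoch_nth_0)
qed

lemma mock_phi_eq:
  fixes a :: "'a::comm_ring_1"
  shows "mock_phi (- (fps_const a * fps_X)) (- fps_X)
    = 1 + (\<Sum>\<^sub>\<infinity>p\<in>partitions_DO. (- 1) ^ ((hd p + 1) div 2)
        * fps_const a ^ ((hd p + 1) div 2 - length p) * fps_X ^ sum_list p)" (is "_ = 1 + ?R")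
proof -
  let ?c = "\<lambda>p. (- 1) ^ ((largest p + 1) div 2) * a ^ ((largest p + 1) div 2 - length p)"
  have "?R = (\<Sum>\<^sub>\<infinity>p\<in>partitions_DO. fps_const (?c p) * fps_X ^ sum_list p)"
    unfolding sign_times_power_eq_fps_const
    by (rule infsum_cong) (simp add: partitions_DO_def partitions_def largest_def)
  also have "\<dots> = gen_fun partitions_DO sum_list ?c"
    by (intro infsum_gen_fun finite_fibre) (auto simp: partitions_DO_def)
  finally have "1 + ?R = gen_fun (\<Union>n. DO_length n) sum_list ?c"
    by (simp add: gen_fun_insert_Nil DO_length_UN largest_def partitions_DO_def)
  moreover have "(\<lambda>n. gen_fun (DO_length n) sum_list ?c) sums gen_fun (\<Union>n. DO_length n) sum_list ?c"
  proof (rule gen_fun_UN_sums)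
    show "n \<le> sum_list p" if "p \<in> DO_length n" for n p
      using that length_le_sum_list[of p] by (auto simp: DO_length_def odd_pos)
    show "finite {p. p \<in> (\<Union>n. DO_length n) \<and> sum_list p = k}" for k
      using DO_length_subset by (intro finite_fibre) blast
  qed (auto simp: DO_length_def)
  \<comment> \<open>The first Pochhammer argument of phi after substituting - alpha q for alpha and
    - q for q: the two inner signs cancel.\<close>
  moreover have "- (- (fps_const a * fps_X) * - fps_X) = - (fps_const a * fps_X\<^sup>2)"
    by (simp add: power2_eq_square mult.assoc)
  ultimately show ?thesis
    unfolding mock_phi_def gen_fun_DO_length sums_iff by simp
qed

section \<open>Odd parts without gaps\<close>

text \<open>\<open>n\<close> counts the different part sizes, so the largest part is
  \<open>2 * n - 1\<close> for positive \<open>n\<close>; multiplicities are free.\<close>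

definition OC_parts :: "nat \<Rightarrow> nat list set" where
  "OC_parts n = {p. sorted_wrt (\<ge>) p \<and> set p = (\<lambda>i. 2 * i + 1) ` {..<n}}"

lemma OC_parts_subset: "OC_parts n \<subseteq> insert [] partitions"
  by (auto simp: OC_parts_def partitions_def)

lemma OC_parts_0: "OC_parts 0 = {[]}"
  by (auto simp: OC_parts_def)

lemma hd_OC_parts:
  assumes "p \<in> OC_parts (Suc n)"
  shows "p \<noteq> []" "hd p = 2 * n + 1"
proof -
  have p: "sorted_wrt (\<ge>) p" "set p = (\<lambda>i. 2 * i + 1) ` {..<Suc n}"
    using assms by (auto simp: OC_parts_def)
  show ne: "p \<noteq> []" using p(2) by auto
  have "hd p \<le> 2 * n + 1" using hd_in_set[OF ne] unfolding p(2) by auto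
  moreover have "2 * n + 1 \<in> set p" unfolding p(2) by blast
  hence "2 * n + 1 \<le> hd p" using p(1) by (cases p) auto
  ultimately show "hd p = 2 * n + 1" by simp
qed

lemma length_ge_OC_parts:
  assumes "p \<in> OC_parts n"
  shows "n \<le> length p"
proof -
  have "card (set p) = n"
    using assms by (simp add: OC_parts_def card_image inj_on_def)
  thus ?thesis using card_length[of p] by simp
qed

text \<open>The head is itself odd, so having no gaps means that the set of parts consists of all
  odd numbers up to it. The index starts at \<open>Suc n\<close> because \<open>OC_parts 0\<close>
  holds only the empty list.\<close>

lemma OC_parts_UN: "(\<Union>n. OC_parts (Suc n)) = partitions_OC"
proof (intro equalityI subsetI)
  fix p assume "p \<in> (\<Union>n. OC_parts (Suc n))"
  then obtain n where p: "p \<in> OC_parts (Suc n)" by blast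
  have set: "set p = (\<lambda>i. 2 * i + 1) ` {..<Suc n}" using p by (simp add: OC_parts_def)
  have "k \<in> set p" if "odd k" "k \<le> hd p" for k
    using that unfolding set hd_OC_parts(2)[OF p] by (auto elim!: oddE)
  moreover have "odd x" if "x \<in> set p" for x
    using that unfolding set by auto
  ultimately show "p \<in> partitions_OC"
    using hd_OC_parts(1)[OF p] OC_parts_subset[of "Suc n"] p by (auto simp: partitions_OC_def)
next
  fix p assume p: "p \<in> partitions_OC"
  hence "odd (hd p)" by (auto simp: partitions_OC_def partitions_def)
  then obtain n where n: "hd p = 2 * n + 1" by (elim oddE)
  have "x \<in> set p \<longleftrightarrow> odd x \<and> x \<le> hd p" for x
    using p hd_partition_ge[of p x] unfolding partitions_OC_def by blast
  hence "set p = {k. odd k \<and> k \<le> hd p}" by blast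
  also have "\<dots> = (\<lambda>i. 2 * i + 1) ` {..<Suc n}"
  proof (intro equalityI subsetI)
    fix k assume k: "k \<in> {k. odd k \<and> k \<le> hd p}"
    then obtain i where "k = 2 * i + 1" by (auto elim: oddE)
    with k n show "k \<in> (\<lambda>i. 2 * i + 1) ` {..<Suc n}" by simp
  qed (use n in auto)
  finally show "p \<in> (\<Union>n. OC_parts (Suc n))"
    using p by (auto simp: OC_parts_def partitions_OC_def partitions_def)
qed

lemma OC_parts_disjoint:
  assumes "m \<noteq> n"
  shows "OC_parts m \<inter> OC_parts n = {}"
proof -
  have "card (set p) = k" if "p \<in> OC_parts k" for p k
    using that by (simp add: OC_parts_def card_image inj_on_def)
  thus ?thesis using assms by (metis disjoint_iff)
qed

text \<open>After removing one copy of the largest part, the two cases are whether another copy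
  remains. Both use the same map, so disjointness comes from that of the two families.\<close>

lemma OC_parts_Suc:
  "OC_parts (Suc n) = Cons (2 * n + 1) ` OC_parts (Suc n) \<union> Cons (2 * n + 1) ` OC_parts n"
proof (intro equalityI subsetI)
  fix p assume p: "p \<in> OC_parts (Suc n)"
  define r where "r = tl p"
  have r: "p = (2 * n + 1) # r"
    using hd_OC_parts[OF p] unfolding r_def by (metis list.collapse)
  have sorted: "sorted_wrt (\<ge>) r" and
    set: "insert (2 * n + 1) (set r) = insert (2 * n + 1) ((\<lambda>i. 2 * i + 1) ` {..<n})"
    using p unfolding r OC_parts_def lessThan_Suc image_insert by simp_all
  have "2 * n + 1 \<notin> (\<lambda>i. 2 * i + 1) ` {..<n}" by auto
  hence "set r = (\<lambda>i. 2 * i + 1) ` {..<n}" if "2 * n + 1 \<notin> set r"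
    using set that by (metis insert_ident)
  moreover have "set r = (\<lambda>i. 2 * i + 1) ` {..<Suc n}" if "2 * n + 1 \<in> set r"
    using set that by (simp add: insert_absorb lessThan_Suc)
  ultimately have "r \<in> OC_parts (Suc n) \<or> r \<in> OC_parts n"
    using sorted by (auto simp: OC_parts_def)
  thus "p \<in> Cons (2 * n + 1) ` OC_parts (Suc n) \<union> Cons (2 * n + 1) ` OC_parts n"
    using r by blast
qed (auto simp: OC_parts_def lessThan_Suc)

text \<open>Adding a repeated largest part increases only the length and yields \<open>- a\<close>;
  adding a new largest part also increases \<open>n\<close> and yields only the sign.\<close>

lemma gen_fun_OC_parts:
  fixes a :: "'a::comm_ring_1"
  shows "gen_fun (OC_parts n) sum_list (\<lambda>p. (- 1) ^ length p * a ^ (length p - n))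
    = (- fps_X) ^ n\<^sup>2 * recip (qpoch (- (fps_const a * fps_X)) (fps_X\<^sup>2) n)"
proof -
  let ?c = "\<lambda>n p. (- 1) ^ length p * a ^ (length p - n)"
  let ?G = "\<lambda>n. gen_fun (OC_parts n) sum_list (?c n)"
  have "qpoch (- (fps_const a * fps_X)) (fps_X\<^sup>2) n * ?G n = (- fps_X) ^ n\<^sup>2"
  proof (induction n)
    case 0
    thus ?case by (simp add: OC_parts_0 gen_fun_singleton qpoch_def)
  next
    case (Suc n)
    \<comment> \<open>A single weight has to serve both families, although the exponent of \<open>a\<close> depends on \<open>n\<close>.\<close>
    define c where "c p = (if p \<in> OC_parts n then ?c n p else ?c (Suc n) p)" for p
    have c: "c p = ?c (Suc n) p" if "p \<in> OC_parts (Suc n)" for p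
      using that OC_parts_disjoint[of n "Suc n"] by (auto simp: c_def)
    have in_Suc: "(2 * n + 1) # p \<in> OC_parts (Suc n)" if "p \<in> OC_parts n \<union> OC_parts (Suc n)" for p
      using that OC_parts_Suc[of n] by blast
    have "(1 - fps_const (- a) * fps_X ^ (2 * n + 1)) * gen_fun (OC_parts (Suc n)) sum_list c
        = fps_const (- 1) * fps_X ^ (2 * n + 1) * gen_fun (OC_parts n) sum_list c"
    proof (rule gen_fun_recurrence[OF OC_parts_Suc _ _ _ finite_fibre[OF OC_parts_subset]])
      show "Cons (2 * n + 1) ` OC_parts (Suc n) \<inter> Cons (2 * n + 1) ` OC_parts n = {}"
        using OC_parts_disjoint[of "Suc n" n] by auto
    next
      fix p assume p: "p \<in> OC_parts (Suc n)"
      have "Suc (length p) - Suc n = Suc (length p - Suc n)"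
        using length_ge_OC_parts[OF p] by simp
      thus "c ((2 * n + 1) # p) = - a * c p"
        using p in_Suc[of p] by (simp add: c)
    next
      fix p assume p: "p \<in> OC_parts n"
      \<comment> \<open>\<open>c\<close> takes its \<open>Suc n\<close> value on the left and its
        \<open>n\<close> value on the right, with equal exponents of \<open>a\<close>.\<close>
      show "c ((2 * n + 1) # p) = - 1 * c p"
        using p in_Suc[of p] by (simp add: c) (simp add: c_def)
    qed auto
    moreover have "gen_fun (OC_parts (Suc n)) sum_list c = ?G (Suc n)"
      by (rule gen_fun_cong) (rule c)
    moreover have "gen_fun (OC_parts n) sum_list c = ?G n"
      by (rule gen_fun_cong) (simp add: c_def)
    ultimately have rec:
      "(1 + fps_const a * fps_X ^ (2 * n + 1)) * ?G (Suc n) = (- fps_X) ^ (2 * n + 1) * ?G n"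
      by (simp flip: fps_const_neg)
    have pow: "fps_X ^ (2 * n + 1) = (fps_X * (fps_X\<^sup>2) ^ n :: 'a fps)"
      by (simp add: power_mult)
    have "qpoch (- (fps_const a * fps_X)) (fps_X\<^sup>2) (Suc n) * ?G (Suc n)
        = qpoch (- (fps_const a * fps_X)) (fps_X\<^sup>2) n
          * ((1 + fps_const a * fps_X ^ (2 * n + 1)) * ?G (Suc n))"
      unfolding qpoch_Suc pow by (simp add: mult_ac)
    also have "\<dots> = (- fps_X) ^ (2 * n + 1) * (- fps_X) ^ n\<^sup>2"
      unfolding rec Suc.IH[symmetric] by (rule mult.left_commute)
    also have "\<dots> = (- fps_X) ^ (2 * n + 1 + n\<^sup>2)"
      by (simp only: power_add)
    also have "2 * n + 1 + n\<^sup>2 = (Suc n)\<^sup>2"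
      by (simp add: power2_eq_square)
    finally show ?case .
  qed
  thus ?thesis by (rule eq_mult_recip) (simp add: qpoch_nth_0)
qed

lemma mock_psi_eq:
  fixes a :: "'a::comm_ring_1"
  shows "mock_psi (- (fps_const a * fps_X)) (- fps_X)
    = (\<Sum>\<^sub>\<infinity>p\<in>partitions_OC. (- 1) ^ length p
        * fps_const a ^ (length p - (hd p + 1) div 2) * fps_X ^ sum_list p)" (is "_ = ?R")
proof -
  let ?c = "\<lambda>p. (- 1) ^ length p * a ^ (length p - (hd p + 1) div 2)"
  have "?R = (\<Sum>\<^sub>\<infinity>p\<in>partitions_OC. fps_const (?c p) * fps_X ^ sum_list p)"
    unfolding sign_times_power_eq_fps_const ..
  also have "\<dots> = gen_fun (\<Union>n. OC_parts (Suc n)) sum_list ?c"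
    unfolding OC_parts_UN by (intro infsum_gen_fun finite_fibre) (auto simp: partitions_OC_def)
  finally have "?R = gen_fun (\<Union>n. OC_parts (Suc n)) sum_list ?c" .
  moreover have "(\<lambda>n. gen_fun (OC_parts (Suc n)) sum_list ?c)
      sums gen_fun (\<Union>n. OC_parts (Suc n)) sum_list ?c"
  proof (rule gen_fun_UN_sums)
    show "n \<le> sum_list p" if p: "p \<in> OC_parts (Suc n)" for n p
    proof -
      have "length p \<le> sum_list p"
        using p by (intro length_le_sum_list) (auto simp: OC_parts_def)
      thus ?thesis using length_ge_OC_parts[OF p] by simp
    qed
    show "finite {p. p \<in> (\<Union>n. OC_parts (Suc n)) \<and> sum_list p = k}" for k
      using OC_parts_subset by (intro finite_fibre) blast
  qed (simp add: OC_parts_disjoint)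
  \<comment> \<open>Here \<open>hd p\<close> is \<open>2 * n + 1\<close>, so
    \<open>(hd p + 1) div 2\<close> is \<open>Suc n\<close> and the common weight agrees with the
    one indexed by the family.\<close>
  moreover have "gen_fun (OC_parts (Suc n)) sum_list ?c
      = (- fps_X) ^ (Suc n)\<^sup>2 * recip (qpoch (- (fps_const a * fps_X)) (fps_X\<^sup>2) (Suc n))" for n
    unfolding gen_fun_OC_parts[symmetric]
    by (rule gen_fun_cong) (simp add: hd_OC_parts)
  ultimately show ?thesis
    by (simp add: mock_psi_def sums_iff)
qed

theorem theorem5p1:
  shows "mock_f (alpha * fps_X) fps_X =
           1 + (\<Sum>\<^sub>\<infinity>p\<in>partitions. rank_sign p * alpha ^ hd p * fps_X ^ sum_list p)
       \<and> mock_phi (- (alpha * fps_X)) (- fps_X) =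
           1 + (\<Sum>\<^sub>\<infinity>p\<in>partitions_DO.
                 (- 1) ^ ((hd p + 1) div 2) * alpha ^ ((hd p + 1) div 2 - length p) * fps_X ^ sum_list p)
       \<and> mock_psi (- (alpha * fps_X)) (- fps_X) =
           (\<Sum>\<^sub>\<infinity>p\<in>partitions_OC.
              (- 1) ^ length p * alpha ^ (length p - (hd p + 1) div 2) * fps_X ^ sum_list p)"
  by (intro conjI mock_f_eq mock_phi_eq mock_psi_eq)

end
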